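(* Let $n,r$ be positive integers with $n\ge r$, and let $k_1,\dots,k_r$ be integers. Then $$\sum_{k=r}^n{n \brace k}L^{(k_1,k_2,\cdots,k_r)}(k,r) =\sum_{k=r}^n {k \brace k_1,k_2,\cdots,k_r} \binom{n}{k} F_{n-k}^{(r)}(1),$$ where ${n \brace k}$ is the ordinary Stirling number of the second kind, $L^{(k_1,\cdots,k_r)}(k,r)$ is the multi-Lah number, ${k \brace k_1,\cdots,k_r}$ is the multi-Stirling number of the second kind, and $F_{m}^{(r)}(x)$ is the Fubini polynomial of order $r$.
   Context: For integers $k_1,\dots,k_r$ the multiple logarithm of index $(k_1,\dots,k_r)$ is the power series $$\mathrm{Li}_{k_1,k_2,\cdots,k_r}(t)=\sum_{0<m_1<m_2<\cdots<m_r}\frac{t^{m_r}}{m_1^{k_1}m_2^{k_2}\cdots m_r^{k_r}},$$ the sum being over integers $m_1,\dots,m_r$. The multi-Stirling numbers of the second kind ${n \brace k_1,k_2,\cdots,k_r}$ are defined by the generating function (as a power series in $t$) $$\mathrm{Li}_{k_1,k_2,\cdots,k_r}(1-e^{1-e^t})=\sum_{n=r}^\infty {n \brace k_1,k_2,\cdots,k_r}\frac{t^n}{n!}.$$ The multi-Lah numbers $L^{(k_1,k_2,\cdots,k_r)}(n,r)$ are defined by $$\frac{\mathrm{Li}_{k_1,\cdots,k_r}(1-e^{-t})}{(1-t)^r}=\sum_{n=r}^\infty L^{(k_1,k_2,\cdots,k_r)}(n,r)\frac{t^n}{n!}.$$ The Fubini polynomials $F_n^{(r)}(x)$ of order $r$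 are defined by $$\left(\frac{1}{1-x(e^t-1)}\right)^r=\sum_{n=0}^\infty F_n^{(r)}(x)\frac{t^n}{n!}.$$ The Stirling numbers of the second kind ${n \brace k}$ are given by $\frac{1}{k!}(e^t-1)^k=\sum_{n=k}^\infty {n \brace k}\frac{t^n}{n!}$ for $k\ge 0$. *)

theory Defs
  imports Complex_Main "HOL-Computational_Algebra.Formal_Power_Series" "HOL-Combinatorics.Stirling"
begin

text \<open>An index \<open>(k\<^sub>1, \<dots>, k\<^sub>r)\<close> is a list of integers of length \<open>r\<close>. All generating functions are
  formal power series over the reals.\<close>

(* The leading 0 encodes 0 < m_1, and gives the empty index the conventional value 1. *)
definition increasing_tuples :: "nat \<Rightarrow> nat \<Rightarrow> nat list set" where
  "increasing_tuples r n =
     {ms. length ms = r \<and> sorted_wrt (<) (0 # ms) \<and> last (0 # ms) = n}"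

lemma finite_increasing_tuples: "finite (increasing_tuples r n)"
proof (rule finite_subset)
  have *: "m \<le> last xs" if "sorted_wrt (<) xs" "m \<in> set xs" for m and xs :: "nat list"
    using that by (induction xs) (auto split: if_splits, metis last_in_set less_imp_le)
  have "set ms \<subseteq> {..n}" if ms: "ms \<in> increasing_tuples r n" for ms
  proof
    fix m assume m: "m \<in> set ms"
    have "sorted_wrt (<) (0 # ms)" "last (0 # ms) = n"
      using ms unfolding increasing_tuples_def by blast+
    with *[of "0 # ms" m] m show "m \<in> {..n}" by auto
  qed
  then show "increasing_tuples r n \<subseteq> {ms. set ms \<subseteq> {..n} \<and> length ms = r}"
    unfolding increasing_tuples_def by blast
qed (rule finite_lists_length_eq, simp)

definition multi_Li :: "int list \<Rightarrow> real fps" where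
  "multi_Li ks = Abs_fps (\<lambda>n. \<Sum>ms\<in>increasing_tuples (length ks) n.
     1 / (\<Prod>i<length ks. real (ms ! i) powi (ks ! i)))"

(* The inner series of both compositions below have constant coefficient 0. *)
definition multi_Stirling :: "nat \<Rightarrow> int list \<Rightarrow> real" where
  "multi_Stirling n ks =
     fact n * fps_nth (multi_Li ks oo (1 - (fps_exp 1 oo (1 - fps_exp 1)))) n"

(* The second argument r of L^(k_1,...,k_r)(n,r) is the length of the index. *)
definition multi_Lah :: "int list \<Rightarrow> nat \<Rightarrow> real" where
  "multi_Lah ks n =
     fact n * fps_nth ((multi_Li ks oo (1 - fps_exp (-1))) / (1 - fps_X) ^ length ks) n"

definition Fubini :: "nat \<Rightarrow> nat \<Rightarrow> real \<Rightarrow> real" where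
  "Fubini r n x = fact n * fps_nth ((1 / (1 - fps_const x * (fps_exp 1 - 1))) ^ r) n"

text \<open>The library's recursively defined \<^const>\<open>Stirling\<close> has the expected exponential generating function.\<close>

lemma Stirling_egf:
  "Abs_fps (\<lambda>n. real (Stirling n k) / fact n) = fps_const (1 / fact k) * (fps_exp 1 - 1) ^ k"
proof -
  define f :: "nat \<Rightarrow> real fps" where "f k = fps_const (1 / fact k) * (fps_exp 1 - 1) ^ k" for k
  have deriv: "fps_deriv (f (Suc k)) = fps_const (real (Suc k)) * f (Suc k) + f k" for k
  proof -
    have c: "fps_const (1 / fact (Suc k)) * fps_const (real (Suc k)) = fps_const (1 / fact k :: real)"
      by (simp del: of_nat_Suc add: field_simps)
    have "fps_deriv (f (Suc k)) =
        (fps_const (1 / fact (Suc k)) * fps_const (real (Suc k))) * ((fps_exp 1 - 1) ^ k * fps_exp 1)"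
      unfolding f_def fps_deriv_mult fps_deriv_power
      by (simp del: of_nat_Suc fact_Suc fps_const_mult add: fps_of_nat mult_ac)
    also have "(fps_exp 1 - 1) ^ k * fps_exp 1 = (fps_exp 1 - 1) ^ Suc k + (fps_exp 1 - 1 :: real fps) ^ k"
      by (simp add: algebra_simps)
    finally show ?thesis
      unfolding f_def c [symmetric] by (simp only: distrib_left mult_ac)
  qed
  have "fps_nth (f k) n = real (Stirling n k) / fact n" for n
  proof (induction n arbitrary: k)
    case 0
    show ?case by (cases k) (simp_all add: f_def)
  next
    case (Suc n)
    show ?case
    proof (cases k)
      case 0
      then show ?thesis by (simp add: f_def)
    next
      case (Suc j)
      have "real (Suc n) * fps_nth (f (Suc j)) (Suc n) = fps_nth (fps_deriv (f (Suc j))) n"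
        by simp
      also have "\<dots> = real (Suc j) * fps_nth (f (Suc j)) n + fps_nth (f j) n"
        by (simp only: deriv fps_add_nth fps_mult_left_const_nth)
      also have "\<dots> = real (Stirling (Suc n) (Suc j)) / fact n"
        by (simp add: Suc.IH field_simps)
      finally show ?thesis
        using Suc by (simp del: of_nat_Suc Stirling.simps add: field_simps)
    qed
  qed
  then show ?thesis by (simp add: fps_eq_iff f_def)
qed

end

theory Submission
  imports Defs
begin

text \<open>
  Both sides are \<open>n!\<close> times the coefficient of \<open>t\<^sup>n\<close> in one power series. Put
  \<open>E(t) = e\<^sup>t - 1\<close> and let \<open>G(t) = Li(1 - e\<^sup>-\<^sup>t) / (1 - t)\<^sup>r\<close> be the exponential generating
  function of the multi-Lah numbers. Substituting \<open>E\<close> for \<open>t\<close> in an exponential generating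
  function is the Stirling transform of its coefficients (\<open>fact_nth_compose_exp_minus_1\<close>), so the
  left-hand side belongs to \<open>G(E(t))\<close>. On the other hand
  \<open>G(E(t)) = Li(1 - e\<^bsup>-E(t)\<^esup>) / (1 - E(t))\<^sup>r\<close>, the product of the generating function of the
  multi-Stirling numbers and that of the Fubini numbers of order \<open>r\<close>
  (\<open>multi_Lah_egf_compose\<close>), whose coefficients are the binomial convolution on the right
  (\<open>fact_nth_mult\<close>).

  These arguments yield sums that start at \<open>0\<close>. They may start at \<open>r\<close> because an increasing
  chain of \<open>r\<close> positive integers ends at \<open>r\<close> or later: \<open>Li\<close> is divisible by \<open>t\<^sup>r\<close>, and this
  survives substituting a series without constant term and multiplying by any series.
\<close>

lemma fact_nth_compose_exp_minus_1:
  fixes f :: "real fps"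
  shows "fact n * fps_nth (f oo (fps_exp 1 - 1)) n
       = (\<Sum>k=0..n. real (Stirling n k) * (fact k * fps_nth f k))"
proof -
  have "fps_nth ((fps_exp 1 - 1 :: real fps) ^ k) n = fact k * real (Stirling n k) / fact n" for k
    using arg_cong[OF Stirling_egf[of k], of "\<lambda>g. fps_nth g n"] by (simp add: field_simps)
  then show ?thesis
    by (simp add: fps_compose_nth sum_distrib_left mult_ac)
qed

lemma fact_nth_mult:
  fixes f g :: "real fps"
  shows "fact n * fps_nth (f * g) n
       = (\<Sum>k=0..n. (fact k * fps_nth f k) * real (n choose k) * (fact (n - k) * fps_nth g (n - k)))"
  by (simp add: fps_mult_nth sum_distrib_left binomial_fact mult_ac)

lemma sorted_wrt_less_length_le_last:
  fixes a :: nat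
  shows "sorted_wrt (<) (a # ms) \<Longrightarrow> a + length ms \<le> last (a # ms)"
  by (induction ms arbitrary: a) fastforce+

lemma multi_Li_nth_eq_0: "n < length ks \<Longrightarrow> fps_nth (multi_Li ks) n = 0"
proof -
  assume "n < length ks"
  then have "increasing_tuples (length ks) n = {}"
    using sorted_wrt_less_length_le_last[of 0] unfolding increasing_tuples_def by fastforce
  then show ?thesis by (simp add: multi_Li_def)
qed

lemma multi_Li_compose_nth_eq_0:
  "n < length ks \<Longrightarrow> fps_nth (multi_Li ks oo h) n = 0"
  by (simp add: fps_compose_nth multi_Li_nth_eq_0)

lemma multi_Stirling_eq_0: "n < length ks \<Longrightarrow> multi_Stirling n ks = 0"
  by (simp add: multi_Stirling_def multi_Li_compose_nth_eq_0)

lemma multi_Lah_eq_0: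
  assumes "n < length ks"
  shows "multi_Lah ks n = 0"
proof -
  have "fps_nth ((multi_Li ks oo h) * g) n = 0" for h g
    using assms by (simp add: fps_mult_nth multi_Li_compose_nth_eq_0)
  moreover have "a / (1 - fps_X) ^ length ks = a * inverse ((1 - fps_X) ^ length ks)" for a :: "real fps"
    by (rule fps_divide_unit) simp
  ultimately show ?thesis by (simp add: multi_Lah_def)
qed

lemma fps_exp_uminus_compose:
  fixes h :: "real fps"
  shows "fps_exp (-1) oo h = fps_exp 1 oo (- h)"
proof -
  have "(- h) ^ i = fps_const ((-1) ^ i) * h ^ i" for i
    by (subst power_minus) (simp flip: fps_const_power fps_const_neg)
  then show ?thesis
    by (simp add: fps_eq_iff fps_compose_nth)
qed

text \<open>The substitution \<open>t \<mapsto> e\<^sup>t - 1\<close> turns the inner series \<open>1 - e\<^sup>-\<^sup>t\<close> of the multi-Lah numbers into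
  that of the multi-Stirling numbers, and \<open>1 / (1 - t)\<close> into the Fubini series at \<open>x = 1\<close>.\<close>

lemma multi_Lah_egf_compose:
  "((multi_Li ks oo (1 - fps_exp (-1))) / (1 - fps_X) ^ r) oo (fps_exp 1 - 1)
   = (multi_Li ks oo (1 - (fps_exp 1 oo (1 - fps_exp 1))))
     * (1 / (1 - fps_const 1 * (fps_exp 1 - 1))) ^ r"
proof -
  define E :: "real fps" where "E = fps_exp 1 - 1"
  have E0: "fps_nth E 0 = 0" by (simp add: E_def)
  have "((multi_Li ks oo (1 - fps_exp (-1))) / (1 - fps_X) ^ r) oo E
      = ((multi_Li ks oo (1 - fps_exp (-1))) oo E) / ((1 - fps_X) ^ r oo E)"
    by (rule fps_divide_compose) (simp_all add: E0)
  also have "(multi_Li ks oo (1 - fps_exp (-1))) oo E = multi_Li ks oo ((1 - fps_exp (-1)) oo E)"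
    by (rule fps_compose_assoc[symmetric]) (simp_all add: E0)
  also have "(1 - fps_exp (-1)) oo E = 1 - (fps_exp 1 oo (1 - fps_exp 1))"
    by (simp add: fps_compose_sub_distrib fps_exp_uminus_compose E_def)
  also have "(1 - fps_X) ^ r oo E = (1 - E) ^ r"
    by (simp add: fps_compose_power[symmetric] E0 fps_compose_sub_distrib)
  also have "a / (1 - E) ^ r = a * (1 / (1 - E)) ^ r" for a
    by (simp add: fps_divide_unit E0 fps_inverse_power)
  finally show ?thesis by (simp add: E_def)
qed

theorem theorem5:
  fixes n r :: nat and ks :: "int list"
  assumes "n > 0" and "r > 0" and "n \<ge> r" and "length ks = r"
  shows "(\<Sum>k=r..n. real (Stirling n k) * multi_Lah ks k) =
         (\<Sum>k=r..n. multi_Stirling k ks * real (n choose k) * Fubini r (n - k) 1)"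
proof -
  have drop_zeros: "(\<Sum>k=r..n. f k) = (\<Sum>k=0..n. f k)" if "\<And>k. k < r \<Longrightarrow> f k = 0"
    for f :: "nat \<Rightarrow> real"
    by (rule sum.mono_neutral_left) (use that in auto)
  have "(\<Sum>k=r..n. real (Stirling n k) * multi_Lah ks k)
      = (\<Sum>k=0..n. real (Stirling n k) * multi_Lah ks k)"
    by (rule drop_zeros) (simp add: multi_Lah_eq_0 assms)
  also have "\<dots> = fact n * fps_nth
      (((multi_Li ks oo (1 - fps_exp (-1))) / (1 - fps_X) ^ r) oo (fps_exp 1 - 1)) n"
    by (simp only: fact_nth_compose_exp_minus_1 multi_Lah_def assms)
  also have "\<dots> = (\<Sum>k=0..n. multi_Stirling k ks * real (n choose k) * Fubini r (n - k) 1)"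
    by (simp only: multi_Lah_egf_compose fact_nth_mult multi_Stirling_def Fubini_def)
  also have "\<dots> = (\<Sum>k=r..n. multi_Stirling k ks * real (n choose k) * Fubini r (n - k) 1)"
    by (rule drop_zeros[symmetric]) (simp add: multi_Stirling_eq_0 assms)
  finally show ?thesis .
qed

end
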